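(* Let $(G,P_G)$ be a right-preordered group. The lattice of normal subobjects of $(G,P_G)$ in $\mathbf{RPOGrp}$ is isomorphic, as a lattice, to the lattice of normal subgroups of the group $G$.
   Context: A right-preordered group is a pair $(G,P_G)$ with $G$ a group (not necessarily abelian) and $P_G$ a submonoid of $G$ (the positive cone). Morphisms $(G,P_G)\to(H,P_H)$ in $\mathbf{RPOGrp}$ are group homomorphisms $f$ with $f(P_G)\subseteq P_H$. The kernel of such an $f$ is $(\ker f,\ker f\cap P_G)\rightarrowtail (G,P_G)$. A normal subobject of $(G,P_G)$ is a subobject that is the kernel of some morphism in $\mathbf{RPOGrp}$; normal subobjects are ordered by inclusion. *)

theory Defs
  imports "HOL-Algebra.Algebra"
begin

record 'a pgroup = "'a monoid" +
  pcone :: "'a set"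

locale right_preordered_group = group G for G :: "('a, 'm) pgroup_scheme" (structure) +
  assumes pcone_submonoid: "submonoid (pcone G) G"

definition rpo_hom ::
    "('a, 'm) pgroup_scheme \<Rightarrow> ('b, 'n) pgroup_scheme \<Rightarrow> ('a \<Rightarrow> 'b) set" where
  "rpo_hom G H = {f \<in> hom G H. f ` pcone G \<subseteq> pcone H}"

text \<open>
  A subobject is given by its canonical representative, an inclusion: a monomorphism is an
  injective homomorphism, and it represents the same subobject as the inclusion of its image,
  equipped with the image of the positive cone. The cone of a subobject may be strictly smaller
  than the one induced from \<open>G\<close>.
\<close>
definition rpo_subobject :: "'a pgroup \<Rightarrow> 'a pgroup \<Rightarrow> bool" where
  "rpo_subobject S G \<longleftrightarrow>
     right_preordered_group S \<and>
     (\<exists>K Q. subgroup K G \<and> Q \<subseteq> pcone G \<and> S = G\<lparr>carrier := K, pcone := Q\<rparr>)"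

definition rpo_kernel ::
    "'a pgroup \<Rightarrow> ('b, 'n) pgroup_scheme \<Rightarrow> ('a \<Rightarrow> 'b) \<Rightarrow> 'a pgroup" where
  "rpo_kernel G H f = G\<lparr>carrier := kernel G H f, pcone := kernel G H f \<inter> pcone G\<rparr>"

text \<open>
  The codomain has to live in a fixed type. The choice of \<^typ>\<open>'a set\<close> is no restriction: by
  \<open>rpo_kernel_is_normal_subobject\<close> below, the kernel of a morphism into a right-preordered
  group over an arbitrary type is a normal subobject in this sense.
\<close>
definition rpo_normal_subobject :: "'a pgroup \<Rightarrow> 'a pgroup \<Rightarrow> bool" where
  "rpo_normal_subobject S G \<longleftrightarrow>
     rpo_subobject S G \<and>
     (\<exists>(H :: 'a set pgroup) f.
        right_preordered_group H \<and> f \<in> rpo_hom G H \<and> S = rpo_kernel G H f)"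

definition normal_subobject_lattice :: "'a pgroup \<Rightarrow> 'a pgroup gorder" where
  "normal_subobject_lattice G =
     \<lparr>carrier = {S. rpo_normal_subobject S G}, eq = (=),
      le = (\<lambda>S T. carrier S \<subseteq> carrier T \<and> pcone S \<subseteq> pcone T)\<rparr>"

definition normal_subgroup_lattice :: "('a, 'm) monoid_scheme \<Rightarrow> 'a set gorder" where
  "normal_subgroup_lattice G = \<lparr>carrier = {N. N \<lhd> G}, eq = (=), le = (\<subseteq>)\<rparr>"

definition lattice_iso ::
    "('a, 'm) gorder_scheme \<Rightarrow> ('b, 'n) gorder_scheme \<Rightarrow> ('a \<Rightarrow> 'b) set" where
  "lattice_iso L M =
     {h. bij_betw h (carrier L) (carrier M) \<and>
         (\<forall>x\<in>carrier L. \<forall>y\<in>carrier L.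
            h (x \<squnion>\<^bsub>L\<^esub> y) = h x \<squnion>\<^bsub>M\<^esub> h y \<and> h (x \<sqinter>\<^bsub>L\<^esub> y) = h x \<sqinter>\<^bsub>M\<^esub> h y)}"

lemma group_congI:
  assumes "group A" "carrier B = carrier A" "monoid.mult B = monoid.mult A" "one B = one A"
  shows "group B"
proof -
  interpret A: group A by (rule assms)
  show ?thesis
    by (rule groupI) (use A.m_assoc A.l_inv_ex in \<open>simp_all add: assms(2-4)\<close>)
qed

lemma rpo_kernel_is_normal_subobject:
  fixes G :: "'a pgroup" and H :: "('b, 'n) pgroup_scheme"
  assumes G: "right_preordered_group G" and H: "right_preordered_group H"
    and f: "f \<in> rpo_hom G H"
  shows "rpo_normal_subobject (rpo_kernel G H f) G"
proof -
  interpret G: right_preordered_group G by (rule G)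
  interpret H: right_preordered_group H by (rule H)
  interpret P: submonoid "pcone G" G by (rule G.pcone_submonoid)
  interpret f: group_hom G H f
    using f by unfold_locales (auto simp: rpo_hom_def)
  let ?K = "kernel G H f" and ?S = "rpo_kernel G H f"
  interpret K: normal ?K G by (rule f.normal_kernel)
  have S_group: "group ?S"
  proof -
    have "group (G\<lparr>carrier := ?K\<rparr>)" by (rule K.subgroup_is_group[OF G.group_axioms])
    then show ?thesis by (rule group_congI) (simp_all add: rpo_kernel_def)
  qed
  have "submonoid (pcone ?S) ?S"
    by (unfold_locales) (auto simp: rpo_kernel_def)
  with S_group have S: "right_preordered_group ?S"
    by (simp add: right_preordered_group_def right_preordered_group_axioms_def)
  let ?Q = "\<lparr>carrier = carrier (G Mod ?K), monoid.mult = monoid.mult (G Mod ?K),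
      one = one (G Mod ?K), pcone = carrier (G Mod ?K)\<rparr> :: 'a set pgroup"
  have Q_group: "group ?Q"
    by (rule group_congI[OF K.factorgroup_is_group]) simp_all
  interpret Q: group ?Q by (rule Q_group)
  have "submonoid (pcone ?Q) ?Q"
    using Q.m_closed Q.one_closed by (unfold_locales) auto
  with Q_group have Q: "right_preordered_group ?Q"
    by (simp add: right_preordered_group_def right_preordered_group_axioms_def)
  let ?q = "\<lambda>a. ?K #>\<^bsub>G\<^esub> a"
  have "?q \<in> hom G (G Mod ?K)" by (rule K.r_coset_hom_Mod)
  then have q: "?q \<in> rpo_hom G ?Q"
    using P.subset by (auto simp: rpo_hom_def hom_def)
  have "?q a = ?K \<longleftrightarrow> a \<in> ?K" if "a \<in> carrier G" for a
    using that G.coset_join2[OF _ K.subgroup_axioms] G.coset_join1[OF _ that K.subgroup_axioms]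
    by blast
  moreover have "one ?Q = ?K" by (simp add: FactGroup_def)
  ultimately have "kernel G ?Q ?q = ?K"
    unfolding kernel_def[of G ?Q ?q] using K.subset by auto
  then have "?S = rpo_kernel G ?Q ?q" by (simp add: rpo_kernel_def)
  moreover have "rpo_subobject ?S G"
    unfolding rpo_subobject_def
    by (intro conjI S exI[of _ ?K] exI[of _ "?K \<inter> pcone G"] K.subgroup_axioms)
      (auto simp: rpo_kernel_def)
  ultimately show ?thesis
    using Q q by (auto simp: rpo_normal_subobject_def)
qed

end

theory Submission
  imports Defs
begin

text \<open>
  A normal subobject is a kernel, so its cone is the one induced from \<open>G\<close> and the subobject is
  determined by its carrier. Conversely, if \<open>N\<close> is normal, then \<open>N\<close> with the induced cone is the
  kernel of the projection onto \<open>G Mod N\<close> equipped with the largest possible cone. Hence taking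
  carriers is an order isomorphism.
\<close>

text \<open>Joins and meets are determined by the order, so comparing orders suffices. No order
  axioms are assumed for \<open>L\<close>: they and the existence of bounds are pulled back along
  \<open>h\<close>.\<close>

lemma order_iso_imp_lattice_iso:
  assumes M: "lattice M"
    and eq: "eq L = (=)"
    and bij: "bij_betw h (carrier L) (carrier M)"
    and le: "\<And>x y. x \<in> carrier L \<Longrightarrow> y \<in> carrier L \<Longrightarrow> x \<sqsubseteq>\<^bsub>L\<^esub> y \<longleftrightarrow> h x \<sqsubseteq>\<^bsub>M\<^esub> h y"
  shows "lattice L" "h \<in> lattice_iso L M"
proof -
  interpret M: lattice M by (rule M)
  have h: "h x \<in> carrier M" if "x \<in> carrier L" for x
    using bij that by (auto simp: bij_betw_def)
  have inj: "x = y" if "h x = h y" "x \<in> carrier L" "y \<in> carrier L" for x y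
    using bij that by (auto simp: bij_betw_def dest: inj_onD)
  \<comment> \<open>Antisymmetry is the one axiom that uses injectivity of \<open>h\<close>:
    \<open>M\<close> only identifies the images.\<close>
  interpret L: partial_order L
  proof
    show "x .=\<^bsub>L\<^esub> y" if "x \<sqsubseteq>\<^bsub>L\<^esub> y" "y \<sqsubseteq>\<^bsub>L\<^esub> x" "x \<in> carrier L" "y \<in> carrier L" for x y
      using that by (auto simp: eq le h intro!: inj M.le_antisym)
    show "x \<sqsubseteq>\<^bsub>L\<^esub> z" if "x \<sqsubseteq>\<^bsub>L\<^esub> y" "y \<sqsubseteq>\<^bsub>L\<^esub> z" "x \<in> carrier L" "y \<in> carrier L" "z \<in> carrier L"
      for x y z
      using that M.le_trans[of "h x" "h y" "h z"] by (simp add: le h)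
  qed (simp_all add: eq le h)
  define g where "g = inv_into (carrier L) h"
  have g: "g u \<in> carrier L" "h (g u) = u" if "u \<in> carrier M" for u
    using bij that by (auto simp: g_def bij_betw_def inv_into_into f_inv_into_f)
  \<comment> \<open>The candidate for the join is the preimage of the join of the images; the meet
    below is dual.\<close>
  have sup: "least L (g (h x \<squnion>\<^bsub>M\<^esub> h y)) (Upper L {x, y})"
    if "x \<in> carrier L" "y \<in> carrier L" for x y
    by (rule least_UpperI)
      (use that in \<open>auto simp: le h g Upper_def M.join_left M.join_right intro: M.join_le\<close>)
  have inf: "greatest L (g (h x \<sqinter>\<^bsub>M\<^esub> h y)) (Lower L {x, y})"
    if "x \<in> carrier L" "y \<in> carrier L" for x y
    by (rule greatest_LowerI)
      (use that in \<open>auto simp: le h g Lower_def M.meet_left M.meet_right intro: M.meet_le\<close>)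
  interpret L: lattice L
    by unfold_locales (use sup inf in blast)+
  show "lattice L" by (rule L.lattice_axioms)
  \<comment> \<open>The join of \<open>L\<close> is some least upper bound, so by uniqueness it is
    the element found in \<open>sup\<close>, on which \<open>h\<close> undoes
    \<open>g\<close>.\<close>
  have "h (x \<squnion>\<^bsub>L\<^esub> y) = h x \<squnion>\<^bsub>M\<^esub> h y" if xy: "x \<in> carrier L" "y \<in> carrier L" for x y
    by (rule L.joinI[OF _ xy]) (use L.least_unique[OF sup[OF xy]] g h xy in force)
  moreover have "h (x \<sqinter>\<^bsub>L\<^esub> y) = h x \<sqinter>\<^bsub>M\<^esub> h y" if xy: "x \<in> carrier L" "y \<in> carrier L" for x y
    by (rule L.meetI[OF _ xy]) (use L.greatest_unique[OF inf[OF xy]] g h xy in force)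
  ultimately show "h \<in> lattice_iso L M"
    using bij by (simp add: lattice_iso_def)
qed

text \<open>Conjugation maps each of \<open>N\<close> and \<open>M\<close> into itself, hence also
  the generating set, and this passes to the generated subgroup.\<close>

lemma (in group) normal_generate_Un:
  assumes "N \<lhd> G" "M \<lhd> G"
  shows "generate G (N \<union> M) \<lhd> G"
proof (rule normal_generateI)
  show "N \<union> M \<subseteq> carrier G"
    using assms by (simp add: normal_imp_subgroup subgroup.subset)
  show "g \<otimes> h \<otimes> inv g \<in> N \<union> M" if "h \<in> N \<union> M" "g \<in> carrier G" for h g
    using that assms normal.inv_op_closed2 by fast
qed

lemma (in group) normal_subgroup_lattice_is_lattice:
  "lattice (normal_subgroup_lattice G)"
proof -
  let ?L = "normal_subgroup_lattice G"
  interpret partial_order ?L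
    by unfold_locales (auto simp: normal_subgroup_lattice_def)
  show ?thesis
  proof
    fix N M
    assume "N \<in> carrier ?L" "M \<in> carrier ?L"
    then have N: "N \<lhd> G" and M: "M \<lhd> G"
      by (simp_all add: normal_subgroup_lattice_def)
    \<comment> \<open>This is minimality of the join, which is taken as a generated subgroup rather
      than as a product set so that any subgroup containing \<open>N\<close> and \<open>M\<close>
      contains it.\<close>
    have "generate G (N \<union> M) \<subseteq> K" if "K \<lhd> G" "N \<subseteq> K" "M \<subseteq> K" for K
      using that by (simp add: generate_subgroup_incl normal_imp_subgroup)
    then have "least ?L (generate G (N \<union> M)) (Upper ?L {N, M})"
      using N M normal_generate_Un[OF N M]
      by (intro least_UpperI)
        (auto simp: normal_subgroup_lattice_def Upper_def intro: generate.incl)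
    then show "\<exists>s. least ?L s (Upper ?L {N, M})" ..
    have "greatest ?L (N \<inter> M) (Lower ?L {N, M})"
      using N M normal_subgroup_intersect[OF N M]
      by (intro greatest_LowerI) (auto simp: normal_subgroup_lattice_def Lower_def)
    then show "\<exists>s. greatest ?L s (Lower ?L {N, M})" ..
  qed
qed

lemma normal_imp_rpo_normal_subobject:
  fixes G :: "'a pgroup"
  assumes G: "right_preordered_group G" and N: "N \<lhd> G"
  shows "rpo_normal_subobject (G\<lparr>carrier := N, pcone := N \<inter> pcone G\<rparr>) G"
proof -
  interpret G: right_preordered_group G by (rule G)
  interpret N: normal N G by (rule N)
  let ?Q = "\<lparr>carrier = carrier (G Mod N), monoid.mult = monoid.mult (G Mod N),
      one = one (G Mod N), pcone = carrier (G Mod N)\<rparr> :: 'a set pgroup"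
  let ?q = "\<lambda>a. N #>\<^bsub>G\<^esub> a"
  interpret Q: group ?Q
    by (rule group_congI[OF N.factorgroup_is_group]) simp_all
  have Q: "right_preordered_group ?Q"
    by unfold_locales (use Q.m_closed Q.one_closed in auto)
  \<comment> \<open>Every element of \<open>?Q\<close> is positive, so the projection preserves
    cones as soon as it is defined on all of \<open>pcone G\<close>.\<close>
  have "pcone G \<subseteq> carrier G"
    using G.pcone_submonoid by (rule submonoid.subset)
  then have q: "?q \<in> rpo_hom G ?Q"
    using N.r_coset_hom_Mod by (auto simp: rpo_hom_def hom_def)
  \<comment> \<open>The unit of the quotient is the coset \<open>N\<close>, and
    \<open>N #> a = N\<close> exactly for \<open>a\<close> in \<open>N\<close>.\<close>
  have "kernel G ?Q ?q = N"
    using N.subset G.coset_join1[OF _ _ N.subgroup_axioms] G.coset_join2[OF _ N.subgroup_axioms]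
    by (auto simp: kernel_def FactGroup_def)
  then show ?thesis
    using rpo_kernel_is_normal_subobject[OF G Q q]
    by (simp add: rpo_kernel_def)
qed

text \<open>Both facts are read off from a presentation of \<open>S\<close> as a kernel. The second
  rebuilds \<open>S\<close> from its carrier, which makes \<open>carrier\<close> injective on normal
  subobjects.\<close>

lemma rpo_normal_subobjectD:
  assumes G: "right_preordered_group G" and S: "rpo_normal_subobject S G"
  shows "carrier S \<lhd> G" "S = G\<lparr>carrier := carrier S, pcone := carrier S \<inter> pcone G\<rparr>"
proof -
  obtain H :: "'a set pgroup" and f where H: "right_preordered_group H"
    and f: "f \<in> rpo_hom G H" and S: "S = rpo_kernel G H f"
    using S by (auto simp: rpo_normal_subobject_def)
  interpret f: group_hom G H f
    using G H f
    by (simp add: group_hom_def group_hom_axioms_def right_preordered_group_def rpo_hom_def)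
  show "carrier S \<lhd> G" "S = G\<lparr>carrier := carrier S, pcone := carrier S \<inter> pcone G\<rparr>"
    using f.normal_kernel by (simp_all add: S rpo_kernel_def)
qed

theorem mainTheorem5:
  fixes G :: "'a pgroup"
  assumes "right_preordered_group G"
  shows "lattice (normal_subobject_lattice G) \<and>
    lattice (normal_subgroup_lattice G) \<and>
    (\<exists>h. h \<in> lattice_iso (normal_subobject_lattice G) (normal_subgroup_lattice G))"
proof -
  interpret G: right_preordered_group G by (rule assms)
  let ?L = "normal_subobject_lattice G" and ?M = "normal_subgroup_lattice G"
  have M: "lattice ?M"
    by (rule G.normal_subgroup_lattice_is_lattice)
  have eq: "eq ?L = (=)"
    by (simp add: normal_subobject_lattice_def)
  have bij: "bij_betw carrier (carrier ?L) (carrier ?M)"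
    \<comment> \<open>The inverse equips a normal subgroup with the induced cone. The equation for
      \<open>S\<close> is reversed because as a left-to-right rewrite rule it would loop.\<close>
    by (rule bij_betw_byWitness[where f' = "\<lambda>N. G\<lparr>carrier := N, pcone := N \<inter> pcone G\<rparr>"])
      (auto simp: normal_subobject_lattice_def normal_subgroup_lattice_def
        rpo_normal_subobjectD(2)[OF assms, symmetric]
        intro: rpo_normal_subobjectD(1)[OF assms] normal_imp_rpo_normal_subobject[OF assms])
  have cone: "pcone S = carrier S \<inter> pcone G" if "rpo_normal_subobject S G" for S
    using arg_cong[OF rpo_normal_subobjectD(2)[OF assms that], of pcone] by simp
  \<comment> \<open>The order on subobjects also compares cones, but \<open>cone\<close> makes that
    comparison follow from inclusion of the carriers.\<close>
  have le: "S \<sqsubseteq>\<^bsub>?L\<^esub> T \<longleftrightarrow> carrier S \<sqsubseteq>\<^bsub>?M\<^esub> carrier T"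
    if "S \<in> carrier ?L" "T \<in> carrier ?L" for S T
    using that by (auto simp: normal_subobject_lattice_def normal_subgroup_lattice_def cone)
  show ?thesis
    using M order_iso_imp_lattice_iso[OF M eq bij le] by blast
qed

end
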